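(* Let $G$ be a graph of order $n$ with minimum degree $\delta(G)$. If $\delta(G)\geq \sqrt{n}$, then $G$ has a $2$-proper partition $\mathcal{P}$ with $|\mathcal{P}|\leq (n-1)/\delta(G)$.
   Context: All graphs are finite and simple. The order of a graph is its number of vertices, and $\delta(G)$ is the minimum degree of $G$. A graph $G$ is $k$-connected if the removal of any collection of fewer than $k$ vertices from $G$ results in a connected graph with at least two vertices (so a $k$-connected graph with $k\ge 1$ has at least $k+1$ vertices). For an integer $k\ge 1$, a partition $\mathcal{P}$ of the vertex set $V(G)$ is $k$-proper if for every part $P\in\mathcal{P}$ the induced subgraph $G[P]$ is $k$-connected. $|\mathcal{P}|$ denotes the number of parts. *)

theory Defs
  imports Complex_Main "HOL-Library.Disjoint_Sets" "Graph_Theory.Digraph_Component"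
begin

text \<open>
  Finite simple graphs are the \<^locale>\<open>graph\<close>s of the library: finite, loop-free, symmetric
  digraphs without parallel arcs. An undirected edge is a pair of opposite arcs, so the degree
  of a vertex is its out-degree (equally, its in-degree). The value below is meaningful only
  if \<open>verts G\<close> is finite and nonempty.
\<close>

definition min_degree :: "('a, 'b) pre_digraph \<Rightarrow> nat" where
  "min_degree G = Min (out_degree G ` verts G)"

text \<open>
  \<open>connected\<close> must be qualified: the unqualified name may denote topological connectedness.
\<close>

definition k_connected :: "nat \<Rightarrow> ('a, 'b) pre_digraph \<Rightarrow> bool" where
  "k_connected k G \<longleftrightarrow>
    (\<forall>S \<subseteq> verts G. finite S \<and> card S < k \<longrightarrow>
      Digraph_Component.connected (G \<restriction> (verts G - S)) \<and> card (verts G - S) \<ge> 2)"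

definition k_proper_partition :: "nat \<Rightarrow> ('a, 'b) pre_digraph \<Rightarrow> 'a set set \<Rightarrow> bool" where
  "k_proper_partition k G \<P> \<longleftrightarrow>
    partition_on (verts G) \<P> \<and> (\<forall>P \<in> \<P>. k_connected k (G \<restriction> P))"

end

theory Submission
  imports Defs
begin

text \<open>
  Write \<open>e\<close> for the minimum degree and \<open>n\<close> for the order, so \<open>n \<le> e\<^sup>2\<close> and every admissible
  number of parts is at most \<open>(n - 1) / e < e\<close>. The square root condition enters through this
  remark: if a vertex \<open>v\<close> is left over while its at least \<open>e\<close> neighbours are covered by fewer
  than \<open>e\<close> parts, then two neighbours share a part, and \<open>v\<close> can be added to that part without
  losing 2-connectedness (\<open>splits_absorb\<close>). Cut vertices can therefore be deleted and put back
  later; what has to be controlled is the number of parts.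

  Components are treated separately, so let the graph be connected. The proof is by induction on
  \<open>e\<close> (\<open>splits_connected\<close>): the components of \<open>G - v\<close>, for a cut vertex \<open>v\<close>, have minimum
  degree at least \<open>e - 1\<close>. Call such a component \<open>C\<close> good if it has a partition into at most
  \<open>|C| / e\<close> parts, and saving if \<open>C + v\<close> has such a partition, still with at most \<open>|C| / e\<close>
  parts.

  \<^item> If all components at \<open>v\<close> are good, their partitions have together at most \<open>(n - 1) / e\<close>
    parts, and \<open>v\<close> is added to one of the parts (\<open>splits_of_good_comps\<close>).

  \<^item> If some component \<open>C\<close> at \<open>v\<close> is saving but not good, partition \<open>C + v\<close> within \<open>|C| / e\<close>
    parts and the other components by induction. Taking the bound \<open>(|K| - 1) / (e - 1)\<close> for every
    component \<open>K\<close> would exceed \<open>(n - 1) / e\<close> by at most one part because \<open>n \<le> e\<^sup>2\<close>, and since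
    \<open>C\<close> is not good, the partition of \<open>C + v\<close> has at least one part fewer than this bound allows
    for \<open>C\<close> (\<open>splits_of_saving_comp\<close>).

  \<^item> A cut vertex of one of these two kinds exists. Otherwise take a smallest component \<open>C\<close>, over
    all cut vertices \<open>v\<close>, that is not good, and the block \<open>B\<close> of \<open>C + v\<close> containing \<open>v\<close>. All that
    remains of \<open>C\<close> hangs on single vertices of \<open>B - v\<close> and is good by minimality. If \<open>|B| > e\<close>,
    then \<open>B\<close> pays for itself as an additional part, and \<open>C\<close> is saving. If \<open>|B| \<le> e\<close>, each vertex
    of \<open>B - v\<close> has many neighbours in the pieces hanging on it, by \<open>n \<le> e\<^sup>2\<close> more than these
    have parts, so that it is absorbed there, and \<open>C\<close> is good
    (\<open>good_or_saving_of_smaller_good\<close>).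

  All of this is about vertex sets under a symmetric irreflexive adjacency relation; digraphs
  come in only at the end.
\<close>

section \<open>Connected vertex sets\<close>

locale simple_adjacency =
  fixes adj :: "'a \<Rightarrow> 'a \<Rightarrow> bool"
  assumes adj_sym: "adj x y \<Longrightarrow> adj y x"
    and adj_irrefl: "\<not> adj x x"
begin

definition closed_in :: "'a set \<Rightarrow> 'a set \<Rightarrow> bool" where
  "closed_in S A \<longleftrightarrow> A \<subseteq> S \<and> (\<forall>a\<in>A. \<forall>b\<in>S. adj a b \<longrightarrow> b \<in> A)"

text \<open>
  Connectedness in its cut form: no set of vertices other than the empty and the full one is
  closed under adjacency. This makes unions and deletions accessible without paths.
\<close>

definition conn :: "'a set \<Rightarrow> bool" where
  "conn S \<longleftrightarrow> S \<noteq> {} \<and> (\<forall>A. closed_in S A \<longrightarrow> A \<noteq> {} \<longrightarrow> A = S)"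

lemma connI:
  assumes "S \<noteq> {}" and "\<And>A. closed_in S A \<Longrightarrow> A \<noteq> {} \<Longrightarrow> A = S"
  shows "conn S"
  using assms by (auto simp: conn_def)

lemma connD: "conn S \<Longrightarrow> closed_in S A \<Longrightarrow> A \<noteq> {} \<Longrightarrow> A = S"
  by (auto simp: conn_def)

lemma conn_nonempty: "conn S \<Longrightarrow> S \<noteq> {}"
  by (auto simp: conn_def)

lemma conn_singleton: "conn {x}"
  by (auto simp: conn_def closed_in_def)

lemma closed_in_subset: "closed_in S A \<Longrightarrow> A \<subseteq> S"
  by (auto simp: closed_in_def)

lemma closed_in_Int: "closed_in S A \<Longrightarrow> T \<subseteq> S \<Longrightarrow> closed_in T (A \<inter> T)"
  by (auto simp: closed_in_def)

text \<open>A connected set that meets a closed set cannot leave it; closed sets thus serve as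
  unions of components.\<close>

lemma conn_subset_closed:
  assumes "conn K" "K \<subseteq> S" "closed_in S A" "K \<inter> A \<noteq> {}"
  shows "K \<subseteq> A"
  using connD[OF assms(1) closed_in_Int[OF assms(3,2)]] assms(4) by blast

lemma conn_Union:
  assumes "\<F> \<noteq> {}" "\<And>K. K \<in> \<F> \<Longrightarrow> conn K" "\<And>K. K \<in> \<F> \<Longrightarrow> x \<in> K"
  shows "conn (\<Union>\<F>)"
proof (rule connI)
  show "\<Union>\<F> \<noteq> {}" using assms by auto
  fix A assume A: "closed_in (\<Union>\<F>) A" "A \<noteq> {}"
  have *: "K \<subseteq> A" if "K \<in> \<F>" "K \<inter> A \<noteq> {}" for K
    using conn_subset_closed[OF assms(2) _ A(1)] that by blast
  obtain K where "K \<in> \<F>" "K \<inter> A \<noteq> {}"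
    using A(2) closed_in_subset[OF A(1)] by blast
  then have "x \<in> A" using * assms(3) by blast
  then show "A = \<Union>\<F>" using * assms(3) closed_in_subset[OF A(1)] by blast
qed

lemma conn_Un: "conn A \<Longrightarrow> conn B \<Longrightarrow> A \<inter> B \<noteq> {} \<Longrightarrow> conn (A \<union> B)"
  using conn_Union[of "{A, B}"] by fastforce

lemma conn_edge: "adj a b \<Longrightarrow> conn {a, b}"
  using adj_sym[of a b] unfolding conn_def closed_in_def by blast

lemma conn_Un_edge:
  assumes "conn A" "conn B" "a \<in> A" "b \<in> B" "adj a b"
  shows "conn (A \<union> B)"
proof -
  have "conn ((A \<union> {a, b}) \<union> B)"
    using assms by (intro conn_Un conn_edge) auto
  moreover have "(A \<union> {a, b}) \<union> B = A \<union> B" using assms by auto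
  ultimately show ?thesis by simp
qed

lemma conn_insert: "conn A \<Longrightarrow> a \<in> A \<Longrightarrow> adj a b \<Longrightarrow> conn (insert b A)"
  using conn_Un_edge[of A "{b}" a b] conn_singleton by simp

lemma conn_leaving_edge:
  assumes "conn S" "A \<subseteq> S" "A \<noteq> {}" "A \<noteq> S"
  obtains a b where "a \<in> A" "b \<in> S - A" "adj a b"
  using assms connD[of S A] by (auto simp: closed_in_def)

definition comp_of :: "'a set \<Rightarrow> 'a \<Rightarrow> 'a set" where
  "comp_of S x = \<Union>{K. K \<subseteq> S \<and> conn K \<and> x \<in> K}"

definition comps :: "'a set \<Rightarrow> 'a set set" where
  "comps S = comp_of S ` S"

lemma comp_subset: "comp_of S x \<subseteq> S"
  by (auto simp: comp_of_def)

lemma comp_self: "x \<in> S \<Longrightarrow> x \<in> comp_of S x"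
  using conn_singleton[of x] by (auto simp: comp_of_def)

lemma conn_comp: "x \<in> S \<Longrightarrow> conn (comp_of S x)"
  unfolding comp_of_def using conn_singleton[of x] by (intro conn_Union[of _ x]) auto

lemma comp_closed: "x \<in> S \<Longrightarrow> closed_in S (comp_of S x)"
  unfolding closed_in_def
proof (intro conjI ballI impI)
  fix a b assume *: "x \<in> S" "a \<in> comp_of S x" "b \<in> S" "adj a b"
  have "conn (insert b (comp_of S x))" using * conn_comp conn_insert by blast
  moreover have "insert b (comp_of S x) \<subseteq> S" "x \<in> insert b (comp_of S x)"
    using * comp_self comp_subset[of S x] by auto
  ultimately show "b \<in> comp_of S x" unfolding comp_of_def by blast
qed (rule comp_subset)

lemma compsD:
  assumes "K \<in> comps S"
  shows "conn K" "closed_in S K" "K \<subseteq> S" "K \<noteq> {}"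
proof -
  obtain x where x: "x \<in> S" "K = comp_of S x" using assms by (auto simp: comps_def)
  show "conn K" "closed_in S K" "K \<subseteq> S" "K \<noteq> {}"
    unfolding x(2)
    using conn_comp[OF x(1)] comp_closed[OF x(1)] comp_subset[of S x] comp_self[OF x(1)] by auto
qed

lemma partition_on_comps: "partition_on S (comps S)"
proof (rule partition_onI)
  show "\<Union>(comps S) = S"
    using compsD(3)[of _ S] comp_self[of _ S] unfolding comps_def by fast
  fix K L assume KL: "K \<in> comps S" "L \<in> comps S" "K \<noteq> L"
  have "K \<subseteq> L" "L \<subseteq> K" if "K \<inter> L \<noteq> {}"
    using that conn_subset_closed[OF compsD(1,3)[OF KL(1)] compsD(2)[OF KL(2)]]
      conn_subset_closed[OF compsD(1,3)[OF KL(2)] compsD(2)[OF KL(1)]] by auto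
  then show "disjnt K L" using KL by (auto simp: disjnt_def)
next
  show "{} \<notin> comps S" using compsD(4)[of "{}" S] by auto
qed

lemma Union_comps: "\<Union>(comps S) = S"
  using partition_on_comps[of S] by (simp add: partition_on_def)

lemma conn_closed_is_comp:
  assumes "conn K" "closed_in S K"
  shows "K \<in> comps S"
proof -
  obtain x where x: "x \<in> K" "x \<in> S"
    using conn_nonempty[OF assms(1)] closed_in_subset[OF assms(2)] by blast
  have "K \<subseteq> comp_of S x" using x assms closed_in_subset[OF assms(2)] by (auto simp: comp_of_def)
  moreover have "comp_of S x \<subseteq> K"
    using conn_subset_closed[OF conn_comp[OF x(2)] comp_subset assms(2)] x comp_self by blast
  ultimately show ?thesis using x by (auto simp: comps_def)
qed

lemma finite_comps: "finite S \<Longrightarrow> finite (comps S)"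
  by (simp add: comps_def)

lemma sum_card_comps:
  assumes "finite S"
  shows "(\<Sum>K\<in>comps S. card K) = card S"
proof -
  have "card (\<Union>(comps S)) = (\<Sum>K\<in>comps S. card K)"
    using partition_onD2[OF partition_on_comps] compsD(3) finite_subset[OF _ assms]
    by (intro card_Union_disjoint) simp_all
  then show ?thesis by (simp add: Union_comps)
qed

section \<open>Nonseparable sets\<close>

text \<open>
  Unlike \<open>biconn\<close> below, this admits the two ends of an edge, so that the maximal nonseparable
  sets are the blocks of a graph, bridges included. Singletons are excluded, since the empty set
  is not connected.
\<close>

definition nonsep :: "'a set \<Rightarrow> bool" where
  "nonsep S \<longleftrightarrow> conn S \<and> (\<forall>x\<in>S. conn (S - {x}))"

definition biconn :: "'a set \<Rightarrow> bool" where
  "biconn S \<longleftrightarrow> 3 \<le> card S \<and> nonsep S"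

lemma nonsep_edge: "adj a b \<Longrightarrow> nonsep {a, b}"
  using adj_irrefl[of a] conn_singleton
  by (auto simp: nonsep_def conn_edge insert_Diff_if)

text \<open>
  Ear addition. The role of the ear is played by a smallest connected \<open>Q \<subseteq> K\<close> that is
  attached to both \<open>w\<close> and \<open>w'\<close>. When a vertex \<open>x\<close> of \<open>Q\<close> is deleted, every component of the
  rest is still attached to \<open>w\<close> or \<open>w'\<close>: an unattached one could have been removed from \<open>Q\<close>.
\<close>

lemma nonsep_ear:
  assumes B: "nonsep B" and w: "w \<in> B" "w' \<in> B" "w \<noteq> w'"
    and K: "finite K" "conn K" "K \<inter> B = {}"
    and ww: "x \<in> K" "adj w x" "x' \<in> K" "adj w' x'"
  obtains Q where "Q \<subseteq> K" "Q \<noteq> {}" "nonsep (B \<union> Q)"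
proof -
  define \<Q> where "\<Q> = {Q. Q \<subseteq> K \<and> conn Q \<and> (\<exists>x\<in>Q. adj w x) \<and> (\<exists>x\<in>Q. adj w' x)}"
  have "K \<in> \<Q>" using K ww by (auto simp: \<Q>_def)
  then obtain Q where Q: "Q \<in> \<Q>" and min: "\<And>R. R \<in> \<Q> \<Longrightarrow> card Q \<le> card R"
    using ex_has_least_nat[of "\<lambda>Q. Q \<in> \<Q>" K card] by blast
  have QK: "Q \<subseteq> K" "conn Q" and finQ: "finite Q" using Q K finite_subset by (auto simp: \<Q>_def)
  obtain q q' where q: "q \<in> Q" "adj w q" and q': "q' \<in> Q" "adj w' q'"
    using Q by (auto simp: \<Q>_def)
  have cB: "conn B" "\<And>x. x \<in> B \<Longrightarrow> conn (B - {x})" using B by (auto simp: nonsep_def)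
  have "conn (B \<union> Q)" using conn_Un_edge[OF cB(1) QK(2) w(1) q] .
  moreover have "conn ((B \<union> Q) - {x})" if x: "x \<in> B" for x
  proof -
    have "conn ((B - {x}) \<union> Q)"
      using conn_Un_edge[OF cB(2)[OF x] QK(2), of w q]
        conn_Un_edge[OF cB(2)[OF x] QK(2), of w' q'] w q q' by (cases "x = w") auto
    moreover have "(B \<union> Q) - {x} = (B - {x}) \<union> Q" using x QK K by auto
    ultimately show ?thesis by simp
  qed
  moreover have "conn ((B \<union> Q) - {x})" if x: "x \<in> Q" for x
  proof -
    (* An unattached component M hangs on x alone, so Q - M would be a smaller ear. *)
    have att: "\<exists>m\<in>M. adj w m \<or> adj w' m" if M: "M \<in> comps (Q - {x})" for M
    proof (rule ccontr)
      assume na: "\<not> ?thesis"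
      note MD = compsD[OF M]
      have "conn (Q - M)"
      proof (rule connI)
        show "Q - M \<noteq> {}" using x MD by auto
        fix A assume A: "closed_in (Q - M) A" "A \<noteq> {}"
        show "A = Q - M"
        proof (cases "x \<in> A")
          case True
          have "closed_in Q (A \<union> M)"
            using A MD True unfolding closed_in_def by blast
          then have "A \<union> M = Q" using connD[OF QK(2)] A by blast
          then show ?thesis using A by (auto simp: closed_in_def)
        next
          case False
          have "closed_in Q A"
            using A MD False adj_sym unfolding closed_in_def by blast
          then have "A = Q" using connD[OF QK(2)] A by blast
          then show ?thesis using x False by simp
        qed
      qed
      then have "Q - M \<in> \<Q>" using QK q q' na by (auto simp: \<Q>_def)
      moreover have "card (Q - M) < card Q"
        using MD finQ by (intro psubset_card_mono) auto
      ultimately show False using min by fastforce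
    qed
    have "conn (\<Union>(insert B ((\<lambda>M. B \<union> M) ` comps (Q - {x}))))"
    proof (rule conn_Union[of _ w])
      fix L assume "L \<in> insert B ((\<lambda>M. B \<union> M) ` comps (Q - {x}))"
      then show "conn L"
        using att cB(1) compsD(1) conn_Un_edge w by blast
    qed (use w in auto)
    moreover have "\<Union>(insert B ((\<lambda>M. B \<union> M) ` comps (Q - {x}))) = (B \<union> Q) - {x}"
      using Union_comps[of "Q - {x}"] x QK K by auto
    ultimately show ?thesis by simp
  qed
  ultimately have "nonsep (B \<union> Q)" by (auto simp: nonsep_def)
  then show ?thesis using that QK q by blast
qed

lemma biconn_absorb:
  assumes "biconn P" "v \<notin> P" "x \<in> P" "y \<in> P" "x \<noteq> y" "adj v x" "adj v y"
  shows "biconn (insert v P)"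
proof -
  have fin: "finite P" using assms(1) card.infinite by (force simp: biconn_def)
  obtain Q where Q: "Q \<subseteq> {v}" "Q \<noteq> {}" "nonsep (P \<union> Q)"
    using nonsep_ear[of P x y "{v}" v v] assms conn_singleton adj_sym
    by (auto simp: biconn_def)
  then have "Q = {v}" by auto
  then show ?thesis using Q assms fin by (auto simp: biconn_def)
qed

section \<open>Partitions into few nonseparable parts\<close>

definition splits :: "'a set \<Rightarrow> nat \<Rightarrow> bool" where
  "splits S t \<longleftrightarrow> (\<exists>\<P>. partition_on S \<P> \<and> (\<forall>P\<in>\<P>. biconn P) \<and> card \<P> \<le> t)"

abbreviation deg :: "'a set \<Rightarrow> 'a \<Rightarrow> nat" where
  "deg S x \<equiv> card {y\<in>S. adj x y}"

lemma splits_mono: "splits S t \<Longrightarrow> t \<le> u \<Longrightarrow> splits S u"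
  by (meson splits_def le_trans)

lemma splits_biconn:
  assumes "biconn S" shows "splits S 1"
proof -
  have "S \<noteq> {}" using assms by (auto simp: biconn_def)
  then show ?thesis using assms
    by (auto simp: splits_def intro!: exI[of _ "{S}"] partition_on_space)
qed

lemma splits_UN:
  assumes "finite I" "\<And>i. i \<in> I \<Longrightarrow> splits (A i) (t i)" "disjoint_family_on A I"
  shows "splits (\<Union>i\<in>I. A i) (\<Sum>i\<in>I. t i)"
proof -
  obtain F where F: "\<And>i. i \<in> I \<Longrightarrow>
      partition_on (A i) (F i) \<and> (\<forall>P\<in>F i. biconn P) \<and> card (F i) \<le> t i"
    using assms(2) unfolding splits_def by metis
  have UF: "\<Union>(F i) = A i" if "i \<in> I" for i
    using F[OF that] by (simp add: partition_on_def)
  have "partition_on (\<Union>i\<in>I. A i) (\<Union>i\<in>I. F i)"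
  proof (rule partition_onI)
    have "\<Union> (\<Union>i\<in>I. F i) = (\<Union>i\<in>I. \<Union>(F i))" by auto
    then show "\<Union> (\<Union>i\<in>I. F i) = (\<Union>i\<in>I. A i)" by (simp add: UF)
    fix p q assume pq: "p \<in> (\<Union>i\<in>I. F i)" "q \<in> (\<Union>i\<in>I. F i)" "p \<noteq> q"
    then obtain i j where ij: "i \<in> I" "j \<in> I" "p \<in> F i" "q \<in> F j" by auto
    have sub: "p \<subseteq> A i" "q \<subseteq> A j" using ij UF by blast+
    show "disjnt p q"
    proof (cases "i = j")
      case True
      then show ?thesis using ij F pq partition_onD2[of "A i" "F i"]
        by (auto simp: disjnt_def disjoint_def)
    next
      case False
      then show ?thesis using sub assms(3) ij
        unfolding disjnt_def disjoint_family_on_def by blast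
    qed
  next
    show "{} \<notin> (\<Union>i\<in>I. F i)" using F partition_onD3 by fastforce
  qed
  moreover have "card (\<Union>i\<in>I. F i) \<le> (\<Sum>i\<in>I. t i)"
  proof -
    have "(\<Sum>i\<in>I. card (F i)) \<le> (\<Sum>i\<in>I. t i)" using F by (intro sum_mono) auto
    then show ?thesis using card_UN_le[OF assms(1), of F] by linarith
  qed
  ultimately show ?thesis using F unfolding splits_def
    by (intro exI[of _ "\<Union>i\<in>I. F i"]) auto
qed

lemma splits_Un:
  assumes "splits A s" "splits B t" "A \<inter> B = {}"
  shows "splits (A \<union> B) (s + t)"
proof -
  let ?A = "\<lambda>i. if i then A else B" and ?t = "\<lambda>i. if i then s else t"
  have "disjoint_family_on ?A UNIV"
    using assms(3) by (auto simp: disjoint_family_on_def)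
  then have "splits (\<Union>i\<in>UNIV. ?A i) (\<Sum>i\<in>UNIV. ?t i)"
    using assms(1,2) by (intro splits_UN) auto
  then show ?thesis by (simp add: UNIV_bool Un_commute add.commute)
qed

text \<open>Pigeonhole: with more neighbours than there are parts, \<open>v\<close> has two neighbours in the
  same part.\<close>

lemma splits_absorb:
  assumes "finite S" "splits S t" "v \<notin> S" "t < deg S v"
  shows "splits (insert v S) t"
proof -
  obtain \<P> where P: "partition_on S \<P>" "\<forall>P\<in>\<P>. biconn P" "card \<P> \<le> t"
    using assms(2) by (auto simp: splits_def)
  have finP: "finite \<P>" using P assms(1) finite_elements by blast
  have "\<exists>P\<in>\<P>. 1 < deg P v"
  proof (rule ccontr)
    assume *: "\<not> ?thesis"
    have "{y\<in>S. adj v y} = (\<Union>P\<in>\<P>. {y\<in>P. adj v y})"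
      using partition_onD1[OF P(1)] by auto
    then have "deg S v \<le> (\<Sum>P\<in>\<P>. deg P v)"
      using card_UN_le[OF finP] by simp
    also have "\<dots> \<le> (\<Sum>P\<in>\<P>. 1)" using * by (intro sum_mono) auto
    finally show False using P assms by simp
  qed
  then obtain P where PP: "P \<in> \<P>" "1 < deg P v" by auto
  then obtain x y where xy: "x \<in> P" "y \<in> P" "x \<noteq> y" "adj v x" "adj v y"
    using card_le_Suc0_iff_eq[of "{y\<in>P. adj v y}"] card.infinite
    by (metis (mono_tags, lifting) One_nat_def mem_Collect_eq not_le not_less_zero)
  have PS: "P \<subseteq> S" using PP P partition_onD1 by blast
  have "biconn (insert v P)" using biconn_absorb[of P v x y] xy P PP PS assms by auto
  moreover have "partition_on (insert v S) (insert (insert v P) (\<P> - {P}))"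
  proof -
    have "partition_on S (insert P (\<P> - {P}))" using P(1) PP(1) by (simp add: insert_absorb)
    moreover have dj: "disjnt P (\<Union>(\<P> - {P}))"
      using partition_onD2[OF P(1)] PP(1) by (auto simp: disjnt_def disjoint_def)
    ultimately have rest: "partition_on (S - P) (\<P> - {P})"
      using partition_on_insert by blast
    have "disjnt (insert v P) (\<Union>(\<P> - {P}))"
      using partition_onD1[OF rest] assms(3) by (auto simp: disjnt_def)
    moreover have "insert v S - insert v P = S - P" using assms(3) by auto
    ultimately show ?thesis using rest PS by (auto simp: partition_on_insert)
  qed
  moreover have "card (insert (insert v P) (\<P> - {P})) \<le> card \<P>"
    using card_Suc_Diff1[OF finP PP(1)] card_insert_le_m1[of "card \<P>" "\<P> - {P}" "insert v P"]
    by simp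
  ultimately show ?thesis using P unfolding splits_def
    by (intro exI[of _ "insert (insert v P) (\<P> - {P})"]) auto
qed

section \<open>Graphs of order at most the square of the minimum degree\<close>

lemma sum_div_le: "(\<Sum>i\<in>I. f i div e) \<le> (\<Sum>i\<in>I. f i) div (e :: nat)"
proof (cases "e = 0")
  case False
  have "(\<Sum>i\<in>I. f i div e) * e \<le> (\<Sum>i\<in>I. f i)"
    by (simp add: sum_distrib_right sum_mono)
  then show ?thesis using False by (simp add: less_eq_div_iff_mult_less_eq)
qed simp

text \<open>Rounding down only helps when bounds of the form \<open>|K| / e\<close> are added up.\<close>

lemma splits_Union_good:
  assumes "finite \<K>" "disjoint \<K>" "\<And>K. K \<in> \<K> \<Longrightarrow> finite K"
    and "\<And>K. K \<in> \<K> \<Longrightarrow> splits K (card K div e)"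
  shows "splits (\<Union>\<K>) (card (\<Union>\<K>) div e)"
proof -
  have "splits (\<Union>K\<in>\<K>. K) (\<Sum>K\<in>\<K>. card K div e)"
    using assms by (intro splits_UN) (auto simp: disjoint_family_on_def disjoint_def)
  moreover have "card (\<Union>\<K>) = (\<Sum>K\<in>\<K>. card K)"
    using assms by (intro card_Union_disjoint) auto
  ultimately show ?thesis using splits_mono sum_div_le[of card e \<K>] by simp
qed

lemma deg_le_of_nbrs:
  assumes "finite A" "a \<in> A" "finite X" "\<And>y. y \<in> S \<Longrightarrow> adj a y \<Longrightarrow> y \<in> A \<or> y \<in> X"
  shows "deg S a + 1 \<le> card A + card X"
proof -
  have "{y\<in>S. adj a y} \<subseteq> (A - {a}) \<union> X" using assms(4) adj_irrefl by auto
  then have "deg S a \<le> card ((A - {a}) \<union> X)" using assms by (intro card_mono) auto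
  also have "\<dots> \<le> card (A - {a}) + card X" by (rule card_Un_le)
  finally show ?thesis using card_Suc_Diff1[OF assms(1,2)] by simp
qed

context
  fixes S :: "'a set" and e :: nat
  assumes fin: "finite S" and connS: "conn S"
    and deg: "\<And>x. x \<in> S \<Longrightarrow> e \<le> deg S x"
    and small: "card S \<le> e * e"
begin

lemma card_gt_deg: "e < card S"
proof -
  obtain x where "x \<in> S" using conn_nonempty[OF connS] by auto
  then show ?thesis using deg_le_of_nbrs[of S x "{}" S] fin deg by fastforce
qed

lemma e_ge_2: "2 \<le> e"
proof (rule ccontr)
  assume "\<not> 2 \<le> e"
  then have "e = 0 \<or> e = 1" by auto
  then show False using card_gt_deg small by auto
qed

text \<open>A union of components of \<open>S - w\<close> contains, apart from possibly \<open>w\<close>, all neighbours of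
  each of its vertices.\<close>

lemma card_closed:
  assumes "closed_in (S - {w}) K" "K \<noteq> {}"
  shows "e \<le> card K"
proof -
  obtain x where x: "x \<in> K" using assms by auto
  have KS: "K \<subseteq> S" using closed_in_subset[OF assms(1)] by auto
  have finK: "finite K" using KS fin finite_subset by blast
  have "deg S x + 1 \<le> card K + card {w}"
    using assms(1) x finK by (intro deg_le_of_nbrs) (auto simp: closed_in_def)
  then show ?thesis using deg[of x] x KS by auto
qed

text \<open>
  If deleting a vertex \<open>x\<close> disconnected \<open>K\<close>, both sides would contain, apart from \<open>v\<close> and \<open>x\<close>,
  all neighbours of their vertices and so have at least \<open>e - 1\<close> vertices each, which makes
  \<open>2 e - 1\<close> together with \<open>x\<close>.
\<close>

lemma small_comp_biconn:
  assumes K: "K \<in> comps (S - {v})" and le: "card K + 3 \<le> 2 * e"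
  shows "biconn K"
proof -
  note KD = compsD[OF K]
  have finK: "finite K" using KD fin finite_subset by blast
  have eK: "e \<le> card K" using card_closed KD by blast
  have half: "e \<le> card A + 1" if A: "closed_in (K - {x}) A" "A \<noteq> {}" for x A
  proof -
    obtain a where a: "a \<in> A" using A(2) by blast
    have sub: "A \<subseteq> K - {x}" using closed_in_subset[OF A(1)] .
    have finA: "finite A" using sub finK finite_subset by blast
    have "y \<in> A \<or> y \<in> {v, x}" if "y \<in> S" "adj a y" for y
      using that a sub KD(2) A(1) by (auto simp: closed_in_def)
    then have "deg S a + 1 \<le> card A + card {v, x}"
      using a finA by (intro deg_le_of_nbrs) auto
    moreover have "card {v, x} \<le> 2" by (simp add: card_insert_if)
    moreover have "e \<le> deg S a" using deg a sub KD(3) by blast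
    ultimately show ?thesis by linarith
  qed
  have "conn (K - {x})" if x: "x \<in> K" for x
  proof (rule connI)
    have cK: "card (K - {x}) + 1 = card K" using card_Suc_Diff1[OF finK x] by simp
    then show "K - {x} \<noteq> {}" using eK le by force
    fix A assume A: "closed_in (K - {x}) A" "A \<noteq> {}"
    show "A = K - {x}"
    proof (rule ccontr)
      assume "A \<noteq> K - {x}"
      moreover have sub: "A \<subseteq> K - {x}" using A by (simp add: closed_in_def)
      moreover have "closed_in (K - {x}) (K - {x} - A)"
        unfolding closed_in_def
      proof (intro conjI ballI impI)
        fix a b assume *: "a \<in> K - {x} - A" "b \<in> K - {x}" "adj a b"
        then show "b \<in> K - {x} - A" using A(1) adj_sym[of a b] by (auto simp: closed_in_def)
      qed auto
      ultimately have "e \<le> card (K - {x} - A) + 1" using half by blast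
      moreover have "e \<le> card A + 1" using half A by blast
      moreover have "card (K - {x} - A) + card A = card (K - {x})"
        using card_Diff_subset[of A "K - {x}"] sub finK
        by (metis card_mono finite_Diff finite_subset le_add_diff_inverse2)
      ultimately show False using cK le by linarith
    qed
  qed
  then show ?thesis using KD eK le by (auto simp: biconn_def nonsep_def)
qed

lemma splits_of_good_comps:
  assumes v: "v \<in> S" and good: "\<And>K. K \<in> comps (S - {v}) \<Longrightarrow> splits K (card K div e)"
  shows "splits S ((card S - 1) div e)"
proof -
  have "splits (\<Union>(comps (S - {v}))) (card (\<Union>(comps (S - {v}))) div e)"
    using fin good compsD(3) finite_subset[of _ "S - {v}"]
    by (intro splits_Union_good finite_comps partition_onD2[OF partition_on_comps]) simp_all
  then have s: "splits (S - {v}) ((card S - 1) div e)" using v by (simp add: Union_comps)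
  have "card S - 1 < e * e" using small card_gt_deg by linarith
  then have "(card S - 1) div e < e" by (rule less_mult_imp_div_less)
  moreover have "{y \<in> S - {v}. adj v y} = {y \<in> S. adj v y}" using adj_irrefl by auto
  ultimately have "(card S - 1) div e < deg (S - {v}) v" using deg[OF v] by simp
  then have "splits (insert v (S - {v})) ((card S - 1) div e)"
    using fin s by (intro splits_absorb) auto
  then show ?thesis using v by (simp add: insert_absorb)
qed

text \<open>
  The induction hypothesis covers only components with at most \<open>(e - 1)\<^sup>2\<close> vertices. At most one
  component can be larger, and then so little is left for the others that they are 2-connected,
  hence good.
\<close>

lemma splits_of_saving_comp:
  assumes v: "v \<in> S" and C: "C \<in> comps (S - {v})" "C \<noteq> S - {v}"
    and bad: "\<not> splits C (card C div e)" and semi: "splits (insert v C) (card C div e)"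
    and IH: "\<And>K. K \<in> comps (S - {v}) \<Longrightarrow> card K \<le> (e - 1) * (e - 1) \<Longrightarrow>
      splits K ((card K - 1) div (e - 1))"
  shows "splits S ((card S - 1) div e)"
proof -
  let ?T = "comps (S - {v})"
  let ?R = "?T - {C}"
  have finT: "finite ?T" using fin by (simp add: finite_comps)
  have dT: "disjoint ?T" using partition_onD2[OF partition_on_comps] .
  have sumT: "(\<Sum>K\<in>?T. card K) = card S - 1"
    using sum_card_comps[of "S - {v}"] fin v by simp
  have sumCR: "(\<Sum>K\<in>?T. f K) = f C + (\<Sum>K\<in>?R. f K)" for f :: "'a set \<Rightarrow> nat"
    using sum.remove[OF finT C(1)] .
  have eT: "e \<le> card K" if "K \<in> ?T" for K using card_closed compsD that by blast
  have UR: "S = insert v C \<union> \<Union>?R"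
    using Union_comps[of "S - {v}"] C(1) v by auto
  have R_disj: "insert v C \<inter> \<Union>?R = {}"
    using dT C(1) compsD(3)[of _ "S - {v}"] by (fastforce simp: disjoint_def)
  have comb: "splits S (card C div e + (\<Sum>K\<in>?R. t K))"
    if "\<And>K. K \<in> ?R \<Longrightarrow> splits K (t K)" for t
  proof -
    have "splits (\<Union>K\<in>?R. K) (\<Sum>K\<in>?R. t K)"
      using that finT dT by (intro splits_UN) (auto simp: disjoint_family_on_def disjoint_def)
    then show ?thesis using splits_Un[OF semi _ R_disj] UR by simp
  qed
  show ?thesis
  proof (cases "\<exists>K\<in>?T. (e - 1) * (e - 1) < card K")
    case True
    then obtain L where L: "L \<in> ?T" "(e - 1) * (e - 1) < card L" by auto
    have others: "splits K (card K div e)" if K: "K \<in> ?T" "K \<noteq> L" for K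
    proof -
      have "(\<Sum>K\<in>{K, L}. card K) \<le> (\<Sum>K\<in>?T. card K)"
        using K L finT by (intro sum_mono2) auto
      then have "card K + card L \<le> card S - 1" using K sumT by simp
      (* Hence card K is at most e\<^sup>2 - 1 - (e - 1)\<^sup>2 - 1 = 2 e - 3. *)
      moreover obtain f where f: "e = Suc f" using e_ge_2 by (cases e) auto
      ultimately have "card K + 3 \<le> 2 * e" using L(2) small card_gt_deg by simp
      then have "biconn K" using small_comp_biconn K by blast
      then have "splits K 1" by (rule splits_biconn)
      moreover have "1 \<le> card K div e" using eT[OF K(1)] e_ge_2 by (simp add: less_eq_div_iff_mult_less_eq)
      ultimately show ?thesis by (rule splits_mono)
    qed
    then have "C = L" using bad C by blast
    then have "splits S (card C div e + (\<Sum>K\<in>?R. card K div e))"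
      using others by (intro comb) auto
    moreover have "card C div e + (\<Sum>K\<in>?R. card K div e) \<le> (card S - 1) div e"
      using sum_div_le[of card e ?T] sumCR[of "\<lambda>K. card K div e"] sumT by simp
    ultimately show ?thesis by (rule splits_mono)
  next
    case False
    let ?t = "\<lambda>K. (card K - 1) div (e - 1)"
    have IH': "splits K (?t K)" if "K \<in> ?T" for K using IH that False by (simp add: not_less)
    define t where "t = card C div e + (\<Sum>K\<in>?R. ?t K)"
    have st: "splits S t" unfolding t_def using IH' by (intro comb) auto
    (* This is the one part saved: C cannot be split into card C div e parts, but into ?t C. *)
    have "card C div e < ?t C" using bad IH'[OF C(1)] splits_mono not_le by blast
    then have "t + 1 \<le> (\<Sum>K\<in>?T. ?t K)" using sumCR[of ?t] by (simp add: t_def)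
    then have "(t + 1) * (e - 1) \<le> (\<Sum>K\<in>?T. ?t K) * (e - 1)" by (rule mult_le_mono1)
    also have "\<dots> \<le> (\<Sum>K\<in>?T. card K - 1)"
      by (simp add: sum_distrib_right sum_mono)
    finally have t1: "(t + 1) * (e - 1) \<le> (\<Sum>K\<in>?T. card K - 1)" .
    have "(\<Sum>K\<in>?T. card K - 1) + card ?T = (\<Sum>K\<in>?T. card K - 1 + 1)"
      by (simp only: sum.distrib) simp
    also have "\<dots> = (\<Sum>K\<in>?T. card K)" using eT e_ge_2 by (intro sum.cong) fastforce+
    finally have t2: "(\<Sum>K\<in>?T. card K - 1) + card ?T = card S - 1" using sumT by simp
    have "?R \<noteq> {}"
    proof
      assume "?R = {}"
      then have "S = insert v C" using UR by (metis Un_empty_right Union_empty)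
      then show False using C compsD(3)[OF C(1)] by auto
    qed
    then have "card ?T \<noteq> 1" "card ?T \<noteq> 0" using C(1) finT by (auto simp: card_1_singleton_iff)
    then have T2: "2 \<le> card ?T" by linarith
    obtain f where f: "e = Suc f" using e_ge_2 by (cases e) auto
    (* With f = e - 1, the bound n \<le> e\<^sup>2 first yields t \<le> f, and then t e \<le> (t + 1) f < n. *)
    have tf: "(t + 1) * f + 2 \<le> card S - 1" using t1 t2 T2 f by simp
    have "card S \<le> f * f + 2 * f + 1" using small f by simp
    then have "(t + 1) * f < (f + 2) * f" using tf by (simp add: algebra_simps)
    then have "t + 1 < f + 2" using mult_less_cancel2 by blast
    then have "t \<le> f" by simp
    then have "t * e \<le> (t + 1) * f" using f by (simp add: algebra_simps)
    then have "t * e \<le> card S - 1" using tf by linarith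
    then have "t \<le> (card S - 1) div e" using e_ge_2 by (simp add: less_eq_div_iff_mult_less_eq)
    then show ?thesis using st splits_mono by blast
  qed
qed

text \<open>
  The block \<open>B\<close> of \<open>C + v\<close> at \<open>v\<close> is obtained as a maximal nonseparable set. By ear addition each
  component \<open>K\<close> of the rest is attached to a single vertex of \<open>B\<close>. This vertex is not \<open>v\<close>,
  because \<open>C\<close> is connected and contains a vertex of \<open>B\<close>, and it separates \<open>K\<close> from \<open>v\<close> in the
  whole graph. So \<open>K\<close> is itself a component at a cut vertex, and smaller than \<open>C\<close>.
\<close>

lemma good_or_saving_of_smaller_good:
  assumes v: "v \<in> S" and C: "C \<in> comps (S - {v})" "C \<noteq> S - {v}"
    and smaller: "\<And>w K. w \<in> S \<Longrightarrow> K \<in> comps (S - {w}) \<Longrightarrow> K \<noteq> S - {w} \<Longrightarrow>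
      card K < card C \<Longrightarrow> splits K (card K div e)"
  shows "splits C (card C div e) \<or> splits (insert v C) (card C div e)"
proof -
  note CD = compsD[OF C(1)]
  let ?D = "insert v C"
  have vC: "v \<notin> C" using CD(3) by auto
  have CS: "C \<subseteq> S" using CD(3) by auto
  have finC: "finite C" using CS fin finite_subset by blast
  have C_nbr: "b \<in> C" if "a \<in> C" "b \<in> S" "adj a b" "b \<noteq> v" for a b
    using that CD(2) by (auto simp: closed_in_def)
  have "C \<noteq> S" using v vC by auto
  then obtain u b where ub: "u \<in> C" "b \<in> S - C" "adj u b"
    using conn_leaving_edge[OF connS CS CD(4)] by blast
  then have "b = v" using C_nbr by blast
  then have uv: "u \<in> C" "adj u v" using ub by auto
  have conn_vC: "conn ?D" using conn_insert[OF CD(1)] uv by blast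
  define \<B> where "\<B> = {B. B \<subseteq> ?D \<and> {v, u} \<subseteq> B \<and> nonsep B}"
  have "\<B> \<subseteq> Pow ?D" by (auto simp: \<B>_def)
  then have "finite \<B>" using finC finite_subset by blast
  moreover have "{v, u} \<in> \<B>"
    using nonsep_edge[of v u] uv adj_sym[of u v] by (simp add: \<B>_def)
  ultimately obtain B where B: "B \<in> \<B>" and Bmax: "\<And>B'. B' \<in> \<B> \<Longrightarrow> B \<subseteq> B' \<Longrightarrow> B = B'"
    using finite_has_maximal[of \<B>] by blast
  have BD: "B \<subseteq> ?D" "v \<in> B" "u \<in> B" "nonsep B" using B by (auto simp: \<B>_def)
  have finB: "finite B" using BD(1) finC finite_subset by blast
  let ?Ks = "comps (?D - B)"
  have K_sub: "K \<subseteq> C - B" if "K \<in> ?Ks" for K using compsD(3)[OF that] BD(2) by auto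
  have U_Ks: "\<Union>?Ks = C - B" using Union_comps[of "?D - B"] BD(2) by auto
  have finK: "finite K" if "K \<in> ?Ks" for K using K_sub[OF that] finC finite_subset by blast
  have finKs: "finite ?Ks" using finC by (simp add: finite_comps)
  have dKs: "disjoint ?Ks" using partition_onD2[OF partition_on_comps] .
  have K_nbr: "b \<in> K" if "K \<in> ?Ks" "a \<in> K" "b \<in> ?D - B" "adj a b" for K a b
    using compsD(2)[OF that(1)] that(2-4) unfolding closed_in_def by blast
  have "\<exists>w. w \<in> B - {v} \<and> (\<exists>x\<in>K. adj w x) \<and> (\<forall>b\<in>B. (\<exists>x\<in>K. adj b x) \<longrightarrow> b = w)"
    if K: "K \<in> ?Ks" for K
  proof -
    note KD = compsD[OF K]
    have "K \<noteq> ?D" using KD(3) BD(2) by auto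
    then obtain a w where aw: "a \<in> K" "w \<in> ?D - K" "adj a w"
      using conn_leaving_edge[OF conn_vC _ KD(4)] KD(3) by blast
    have wB: "w \<in> B" using K_nbr[OF K aw(1) _ aw(3)] aw(2) by blast
    have wa: "adj w a" using aw(3) by (rule adj_sym)
    have uniq: "b = w" if b: "b \<in> B" "x \<in> K" "adj b x" for b x
    proof (rule ccontr)
      assume "b \<noteq> w"
      then obtain Q where Q: "Q \<subseteq> K" "Q \<noteq> {}" "nonsep (B \<union> Q)"
        using nonsep_ear[OF BD(4) b(1) wB _ finK[OF K] KD(1) _ b(2,3) aw(1) wa] K_sub[OF K]
        by blast
      then have "B \<union> Q \<in> \<B>" using BD K_sub[OF K] by (auto simp: \<B>_def)
      then have "B = B \<union> Q" using Bmax by blast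
      then show False using Q K_sub[OF K] by blast
    qed
    have "w \<noteq> v"
    proof
      assume wv: "w = v"
      have "closed_in C K" unfolding closed_in_def
      proof (intro conjI ballI impI)
        fix a b assume ab: "a \<in> K" "b \<in> C" "adj a b"
        show "b \<in> K"
        proof (cases "b \<in> B")
          case True
          then have "b = v" using uniq[OF True ab(1) adj_sym[OF ab(3)]] wv by simp
          then show ?thesis using ab vC by simp
        next
          case False
          then show ?thesis using K_nbr[OF K ab(1) _ ab(3)] ab(2) by blast
        qed
      qed (use K_sub[OF K] in blast)
      then have "K = C" using connD[OF CD(1)] KD(4) by blast
      then show False using K_sub[OF K] BD(3) uv(1) by blast
    qed
    then show ?thesis using wB wa aw(1) uniq by blast
  qed
  then obtain att where att: "\<And>K. K \<in> ?Ks \<Longrightarrow> att K \<in> B - {v}"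
    "\<And>K b x. K \<in> ?Ks \<Longrightarrow> b \<in> B \<Longrightarrow> x \<in> K \<Longrightarrow> adj b x \<Longrightarrow> b = att K"
    by metis
  have K_closed: "closed_in (S - {att K}) K" if K: "K \<in> ?Ks" for K
    unfolding closed_in_def
  proof (intro conjI ballI impI)
    show "K \<subseteq> S - {att K}" using K_sub[OF K] att(1)[OF K] CS by blast
    fix a b assume ab: "a \<in> K" "b \<in> S - {att K}" "adj a b"
    have "b \<notin> B" using att(2)[OF K _ ab(1) adj_sym[OF ab(3)]] ab(2) by blast
    moreover have "b \<in> C"
      using C_nbr[of a b] ab K_sub[OF K] BD(2) \<open>b \<notin> B\<close> by blast
    ultimately show "b \<in> K" using K_nbr[OF K ab(1) _ ab(3)] by blast
  qed
  have K_good: "splits K (card K div e)" if K: "K \<in> ?Ks" for K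
  proof (rule smaller)
    have aC: "att K \<in> C" using att(1)[OF K] BD(1) by blast
    show "att K \<in> S" using aC CS by blast
    show "K \<in> comps (S - {att K})"
      using conn_closed_is_comp[OF compsD(1)[OF K] K_closed[OF K]] .
    have "v \<in> S - {att K}" using v att(1)[OF K] by blast
    then show "K \<noteq> S - {att K}" using K_sub[OF K] vC by blast
    have "K \<subset> C" using K_sub[OF K] aC att(1)[OF K] by blast
    then show "card K < card C" using finC by (rule psubset_card_mono[rotated])
  qed
  have cardC: "card C = card (B - {v}) + card (C - B)"
  proof -
    have "C = (B - {v}) \<union> (C - B)" using BD(1) vC by blast
    then show ?thesis using card_Un_disjoint[of "B - {v}" "C - B"] finB finC by auto
  qed
  have cardB: "card B = card (B - {v}) + 1" using card_Suc_Diff1[OF finB BD(2)] by simp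
  have e0: "0 < e" using e_ge_2 by simp
  show ?thesis
  proof (cases "e + 1 \<le> card B")
    case True
    have "biconn B" using True e_ge_2 BD(4) by (simp add: biconn_def)
    then have "splits B 1" by (rule splits_biconn)
    moreover have "splits (C - B) (card (C - B) div e)"
      using splits_Union_good[OF finKs dKs finK K_good] U_Ks by simp
    ultimately have "splits (B \<union> (C - B)) (1 + card (C - B) div e)"
      by (rule splits_Un) blast
    moreover have "B \<union> (C - B) = ?D" using BD by blast
    moreover have "1 + card (C - B) div e \<le> card C div e"
    proof -
      have "1 + card (C - B) div e = (e + card (C - B)) div e" using e0 by simp
      also have "\<dots> \<le> card C div e" using True cardB cardC by (intro div_le_mono) simp
      finally show ?thesis .
    qed
    ultimately have "splits ?D (card C div e)" using splits_mono by metis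
    then show ?thesis ..
  next
    case False
    (* Now B cannot serve as a part. The set D w collects the pieces hanging on w. *)
    let ?W = "B - {v}"
    define D where "D w = \<Union>{K \<in> ?Ks. att K = w}" for w
    have D_sub: "D w \<subseteq> C - B" for w using K_sub by (auto simp: D_def)
    have finD: "finite (D w)" for w using D_sub[of w] finC finite_subset by blast
    have D_good: "splits (D w) (card (D w) div e)" for w
      unfolding D_def
    proof (rule splits_Union_good)
      show "disjoint {K \<in> ?Ks. att K = w}" using dKs by (auto simp: disjoint_def)
    qed (use finKs finK K_good in auto)
    have D_disj: "D w \<inter> D w' = {}" if "w \<noteq> w'" for w w'
    proof -
      have "K \<inter> K' = {}" if "K \<in> ?Ks" "K' \<in> ?Ks" "att K = w" "att K' = w'" for K K'
        using disjointD[OF dKs that(1,2)] that(3,4) \<open>w \<noteq> w'\<close> by auto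
      then show ?thesis unfolding D_def by blast
    qed
    have U_D: "(\<Union>w\<in>?W. D w) = C - B"
    proof -
      have "(\<Union>w\<in>?W. D w) = \<Union>?Ks" using att(1) unfolding D_def by auto
      then show ?thesis using U_Ks by simp
    qed
    have cardD: "card (C - B) = (\<Sum>w\<in>?W. card (D w))"
      using card_UN_disjoint[of ?W D] finB finD D_disj U_D by simp
    (* All neighbours of w lie in B or in D w. *)
    have degD: "e + 1 \<le> deg (D w) w + card B" if w: "w \<in> ?W" for w
    proof -
      have wC: "w \<in> C" using w BD(1) by blast
      have nb: "y \<in> B \<or> y \<in> {y \<in> D w. adj w y}" if y: "y \<in> S" "adj w y" for y
      proof (cases "y \<in> B")
        case False
        have yC: "y \<in> C" using C_nbr[OF wC y] False BD(2) by blast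
        then obtain K where K: "K \<in> ?Ks" "y \<in> K" using U_Ks False by blast
        have "att K = w" using att(2)[OF K(1) _ K(2) y(2)] w by blast
        then show ?thesis using K y by (auto simp: D_def)
      qed simp
      have "deg S w + 1 \<le> card B + deg (D w) w"
        using nb w finB finD[of w] by (intro deg_le_of_nbrs) auto
      then show ?thesis using deg[of w] wC CS by auto
    qed
    have D_ge: "e \<le> card (D w)" if w: "w \<in> ?W" for w
    proof -
      have "0 < deg (D w) w" using degD[OF w] False by linarith
      then have "D w \<noteq> {}" by auto
      then obtain K where K: "K \<in> ?Ks" "att K = w" by (auto simp: D_def)
      have "e \<le> card K" using card_closed[OF K_closed compsD(4)] K by blast
      also have "\<dots> \<le> card (D w)" using K finD by (intro card_mono) (auto simp: D_def)
      finally show ?thesis .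
    qed
    (* The far side of v takes up at least e of the at most e\<^sup>2 vertices. *)
    have other: "e \<le> card (S - {v} - C)"
    proof (rule card_closed)
      show "closed_in (S - {v}) (S - {v} - C)" unfolding closed_in_def
      proof (intro conjI ballI impI)
        fix a b assume ab: "a \<in> S - {v} - C" "b \<in> S - {v}" "adj a b"
        then show "b \<in> S - {v} - C" using C_nbr[of b a] adj_sym[OF ab(3)] by blast
      qed blast
      show "S - {v} - C \<noteq> {}" using C(2) CD(3) by blast
    qed
    have cardS: "card S = card C + card (S - {v} - C) + 1"
    proof -
      have "card (S - {v}) = card C + card (S - {v} - C)"
        using card_Un_disjoint[of C "S - {v} - C"] CD(3) fin finC
        by (metis Diff_disjoint Diff_partition finite_Diff)
      then show ?thesis using card_Suc_Diff1[OF fin v] by simp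
    qed
    have absorbed: "splits (insert w (D w)) (card (D w) div e)" if w: "w \<in> ?W" for w
    proof (rule splits_absorb[OF finD D_good])
      show "w \<notin> D w" using D_sub w by blast
      (* B, the card B - 2 other sets D w' and the far side of v leave so few vertices to D w
         that it has at most e - card B parts; degD provides e + 1 - card B neighbours. *)
      have "card (C - B) = card (D w) + (\<Sum>w\<in>?W - {w}. card (D w))"
        using cardD sum.remove[of ?W w "\<lambda>w. card (D w)"] w finB by simp
      moreover have "card (?W - {w}) * e \<le> (\<Sum>w\<in>?W - {w}. card (D w))"
        using sum_bounded_below[of "?W - {w}" e "\<lambda>w. card (D w)"] D_ge by simp
      moreover have cW: "card ?W = card (?W - {w}) + 1"
        using card_Suc_Diff1[of ?W w] finB w by simp
      moreover have "card ?W + card (?W - {w}) * e + card (D w) + e + 1 \<le> e * e"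
        using calculation cardC cardS other small by linarith
      ultimately have "card (D w) + card ?W * e < e * e" by simp
      moreover obtain k where k: "e = card ?W + k" using False cardB le_Suc_ex[of "card ?W" e] by auto
      ultimately have "card (D w) < k * e" by (simp add: k algebra_simps)
      then have "card (D w) div e < k" by (rule less_mult_imp_div_less)
      then show "card (D w) div e < deg (D w) w" using degD[OF w] k cardB by linarith
    qed
    have "splits (\<Union>w\<in>?W. insert w (D w)) (\<Sum>w\<in>?W. card (D w) div e)"
    proof (rule splits_UN[OF _ absorbed])
      show "disjoint_family_on (\<lambda>w. insert w (D w)) ?W"
        unfolding disjoint_family_on_def
      proof (intro ballI impI)
        fix w w' assume "w \<in> ?W" "w' \<in> ?W" "w \<noteq> w'"
        then show "insert w (D w) \<inter> insert w' (D w') = {}"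
          using D_disj[of w w'] D_sub[of w] D_sub[of w'] by blast
      qed
    qed (use finB in auto)
    moreover have "(\<Union>w\<in>?W. insert w (D w)) = C"
    proof -
      have "(\<Union>w\<in>?W. insert w (D w)) = ?W \<union> (\<Union>w\<in>?W. D w)" by auto
      also have "\<dots> = ?W \<union> (C - B)" by (simp only: U_D)
      also have "\<dots> = C" using BD(1) vC by blast
      finally show ?thesis .
    qed
    moreover have "(\<Sum>w\<in>?W. card (D w) div e) \<le> card C div e"
    proof -
      have "(\<Sum>w\<in>?W. card (D w) div e) \<le> card (C - B) div e"
        using sum_div_le[of "\<lambda>w. card (D w)" e ?W] cardD by simp
      also have "\<dots> \<le> card C div e" using cardC by (intro div_le_mono) simp
      finally show ?thesis .
    qed
    ultimately have "splits C (card C div e)" using splits_mono by metis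
    then show ?thesis ..
  qed
qed

end

lemma splits_connected:
  assumes "finite S" "conn S" "\<And>x. x \<in> S \<Longrightarrow> e \<le> deg S x" "card S \<le> e * e"
  shows "splits S ((card S - 1) div e)"
  using assms
proof (induction e arbitrary: S)
  case 0
  then show ?case using conn_nonempty by auto
next
  case (Suc f S)
  let ?e = "Suc f"
  note H = Suc.prems
  have e2: "2 \<le> ?e" and eS: "?e < card S" using e_ge_2[OF H] card_gt_deg[OF H] by simp_all
  show ?case
  proof (cases "biconn S")
    case True
    have "1 \<le> (card S - 1) div ?e"
      using eS by (subst less_eq_div_iff_mult_less_eq) auto
    then show ?thesis using splits_biconn[OF True] splits_mono by blast
  next
    case False
    have "3 \<le> card S" using e2 eS by linarith
    then obtain v where v: "v \<in> S" "\<not> conn (S - {v})"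
      using False H(2) by (auto simp: biconn_def nonsep_def)
    have proper: "K \<noteq> S - {v}" if "K \<in> comps (S - {v})" for K
      using compsD(1)[OF that] v(2) by auto
    show ?thesis
    proof (cases "\<forall>K \<in> comps (S - {v}). splits K (card K div ?e)")
      case True
      then show ?thesis using splits_of_good_comps[OF H v(1)] by blast
    next
      case False
      define bad where "bad p \<longleftrightarrow> fst p \<in> S \<and> snd p \<in> comps (S - {fst p}) \<and>
        snd p \<noteq> S - {fst p} \<and> \<not> splits (snd p) (card (snd p) div ?e)" for p
      obtain K where "bad (v, K)" using False v proper by (auto simp: bad_def)
      then obtain p where p: "bad p" and min: "\<And>q. bad q \<Longrightarrow> card (snd p) \<le> card (snd q)"
        using ex_has_least_nat[of bad "(v, K)" "\<lambda>q. card (snd q)"] by blast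
      obtain w C where wC: "p = (w, C)" by (cases p)
      have C: "w \<in> S" "C \<in> comps (S - {w})" "C \<noteq> S - {w}" "\<not> splits C (card C div ?e)"
        using p by (auto simp: bad_def wC)
      have "splits C (card C div ?e) \<or> splits (insert w C) (card C div ?e)"
      proof (rule good_or_saving_of_smaller_good[OF H C(1-3)])
        fix x K assume "x \<in> S" "K \<in> comps (S - {x})" "K \<noteq> S - {x}" "card K < card C"
        then show "splits K (card K div ?e)" using min[of "(x, K)"] by (auto simp: bad_def wC)
      qed
      then have semi: "splits (insert w C) (card C div ?e)" using C(4) by blast
      show ?thesis
      proof (rule splits_of_saving_comp[OF H C semi])
        fix K assume K: "K \<in> comps (S - {w})" "card K \<le> (?e - 1) * (?e - 1)"
        note KD = compsD[OF K(1)]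
        have finK: "finite K" using KD(3) H(1) finite_subset by blast
        have "f \<le> deg K x" if x: "x \<in> K" for x
        proof -
          have "{y \<in> S. adj x y} \<subseteq> insert w {y \<in> K. adj x y}"
            using KD(2) x unfolding closed_in_def by blast
          then have "deg S x \<le> card (insert w {y \<in> K. adj x y})"
            using finK by (intro card_mono) auto
          also have "\<dots> \<le> Suc (deg K x)" by (rule card_insert_le_m1) auto
          finally show ?thesis using H(3)[of x] x KD(3) by auto
        qed
        then show "splits K ((card K - 1) div (?e - 1))"
          using Suc.IH[OF finK KD(1)] K(2) by simp
      qed
    qed
  qed
qed

text \<open>For the passage to components, \<open>|K| - 1\<close> summed over all components \<open>K\<close> is at most
  \<open>|S| - 1\<close>, as there is at least one component.\<close>

lemma splits_graph:
  assumes fin: "finite S" and ne: "S \<noteq> {}"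
    and deg: "\<And>x. x \<in> S \<Longrightarrow> e \<le> deg S x" and small: "card S \<le> e * e"
  shows "splits S ((card S - 1) div e)"
proof -
  let ?T = "comps S"
  have finT: "finite ?T" using fin by (rule finite_comps)
  have dT: "disjoint ?T" using partition_onD2[OF partition_on_comps] .
  have finK: "finite K" if "K \<in> ?T" for K using compsD(3)[OF that] fin finite_subset by blast
  have one: "splits K ((card K - 1) div e)" if K: "K \<in> ?T" for K
  proof (rule splits_connected[OF finK[OF K] compsD(1)[OF K]])
    fix x assume x: "x \<in> K"
    have "{y \<in> S. adj x y} = {y \<in> K. adj x y}"
      using compsD(2)[OF K] x unfolding closed_in_def by blast
    then show "e \<le> deg K x" using deg[of x] x compsD(3)[OF K] by auto
  next
    show "card K \<le> e * e" using card_mono[OF fin compsD(3)[OF K]] small by linarith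
  qed
  have "splits (\<Union>K\<in>?T. K) (\<Sum>K\<in>?T. (card K - 1) div e)"
    using finT dT one by (intro splits_UN) (auto simp: disjoint_family_on_def disjoint_def)
  moreover have "(\<Sum>K\<in>?T. (card K - 1) div e) \<le> (card S - 1) div e"
  proof -
    obtain L where L: "L \<in> ?T" using ne by (auto simp: comps_def)
    have Lpos: "0 < card L" using finK[OF L] compsD(4)[OF L] by (simp add: card_gt_0_iff)
    have "(\<Sum>K\<in>?T. card K - 1) = card L - 1 + (\<Sum>K\<in>?T - {L}. card K - 1)"
      using sum.remove[OF finT L] .
    also have "\<dots> \<le> card L - 1 + (\<Sum>K\<in>?T - {L}. card K)" by (simp add: sum_mono)
    also have "\<dots> = card S - 1"
      using sum.remove[OF finT L, of card] sum_card_comps[OF fin] Lpos by simp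
    finally have "(\<Sum>K\<in>?T. card K - 1) div e \<le> (card S - 1) div e" by (rule div_le_mono)
    then show ?thesis using sum_div_le[of "\<lambda>K. card K - 1" e ?T] by linarith
  qed
  ultimately show ?thesis using splits_mono by (simp add: Union_comps)
qed

end

section \<open>Translation to digraphs\<close>

lemma (in graph) simple_adjacency_dominates: "simple_adjacency (dominates G)"
proof
  fix x y
  show "x \<rightarrow> y \<Longrightarrow> y \<rightarrow> x" using arcs_ends_symmetric[OF sym_arcs] .
  show "\<not> x \<rightarrow> x" using no_loops by (auto simp: arcs_ends_conv)
qed

lemma (in graph) out_degree_eq_card_dominates: "out_degree G x = card {y \<in> verts G. x \<rightarrow> y}"
proof -
  have "inj_on (head G) (out_arcs G x)"
    using no_multi_arcs by (auto simp: inj_on_def out_arcs_def arc_to_ends_def)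
  moreover have "head G ` out_arcs G x = {y \<in> verts G. x \<rightarrow> y}"
    by (auto simp: out_arcs_def arcs_ends_conv)
  ultimately show ?thesis unfolding out_degree_def by (metis card_image)
qed

text \<open>The vertices reachable from a given one form a closed set.\<close>

lemma (in graph) connected_induce_subgraph:
  assumes "simple_adjacency.conn (dominates G) T" "T \<subseteq> verts G"
  shows "Digraph_Component.connected (G \<restriction> T)"
proof -
  interpret A: simple_adjacency "dominates G" by (rule simple_adjacency_dominates)
  let ?r = "(arcs_ends (G \<restriction> T))\<^sup>s"
  have "(u, v) \<in> rtrancl_on T ?r" if uv: "u \<in> T" "v \<in> T" for u v
  proof -
    let ?R = "{w \<in> T. (u, w) \<in> rtrancl_on T ?r}"
    have "A.closed_in T ?R" unfolding A.closed_in_def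
    proof (intro conjI ballI impI)
      fix a b assume ab: "a \<in> ?R" "b \<in> T" "a \<rightarrow> b"
      then have "(a, b) \<in> ?r" by (force simp: symcl_def arcs_ends_conv)
      then show "b \<in> ?R" using ab by (auto intro: rtrancl_on_into_rtrancl_on)
    qed auto
    moreover have "u \<in> ?R" using uv by auto
    ultimately have "?R = T" using A.connD[OF assms(1)] by blast
    then show ?thesis using uv by blast
  qed
  then show ?thesis using A.conn_nonempty[OF assms(1)] by (auto simp: connected_conv)
qed

lemma (in graph) k_connected_2_of_biconn:
  assumes P: "simple_adjacency.biconn (dominates G) P" "P \<subseteq> verts G"
  shows "k_connected 2 (G \<restriction> P)"
proof -
  interpret A: simple_adjacency "dominates G" by (rule simple_adjacency_dominates)
  have P3: "3 \<le> card P" and PP: "A.conn P" "\<And>x. x \<in> P \<Longrightarrow> A.conn (P - {x})"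
    using P(1) by (auto simp: A.biconn_def A.nonsep_def)
  have finP: "finite P" using P(2) finite_verts finite_subset by blast
  have "Digraph_Component.connected ((G \<restriction> P) \<restriction> (P - X)) \<and> 2 \<le> card (P - X)"
    if X: "X \<subseteq> P" "card X < 2" for X
  proof -
    have finX: "finite X" using X finP finite_subset by blast
    have "(G \<restriction> P) \<restriction> (P - X) = G \<restriction> (P - X)" by (auto simp: induce_subgraph_def)
    moreover have "A.conn (P - X)"
    proof (cases "X = {}")
      case False
      then have "card X = 1" using X(2) finX card_gt_0_iff[of X] by linarith
      then obtain x where "X = {x}" by (auto simp: card_1_singleton_iff)
      then show ?thesis using PP X by auto
    qed (use PP in simp)
    moreover have "card (P - X) = card P - card X" using X finX by (simp add: card_Diff_subset)
    ultimately show ?thesis using connected_induce_subgraph[of "P - X"] P(2) P3 X(2) by auto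
  qed
  then show ?thesis by (simp add: k_connected_def)
qed

theorem theorem3:
  fixes G :: "('a, 'b) pre_digraph" and n :: nat
  assumes "graph G"
    and "verts G \<noteq> {}"
    and "card (verts G) = n"
    and "real (min_degree G) \<ge> sqrt (real n)"
  shows "\<exists>\<P>. k_proper_partition 2 G \<P> \<and>
    real (card \<P>) \<le> (real n - 1) / real (min_degree G)"
proof -
  interpret graph G by (rule assms(1))
  interpret A: simple_adjacency "dominates G" by (rule simple_adjacency_dominates)
  let ?d = "min_degree G"
  have n: "0 < n" using assms(2,3) card_gt_0_iff[of "verts G"] by simp
  have deg: "?d \<le> A.deg (verts G) x" if "x \<in> verts G" for x
    using that by (simp add: min_degree_def flip: out_degree_eq_card_dominates)
  have "real n \<le> (real ?d)\<^sup>2" using assms(4) by (rule sqrt_le_D)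
  then have "real n \<le> real (?d * ?d)" by (simp add: power2_eq_square)
  then have nd: "n \<le> ?d * ?d" by (simp only: of_nat_le_iff)
  then have d: "0 < ?d" using n by (cases "?d") auto
  have "A.splits (verts G) ((n - 1) div ?d)"
    using A.splits_graph[OF finite_verts assms(2) deg] assms(3) nd by simp
  then obtain \<P> where P: "partition_on (verts G) \<P>" "\<forall>P\<in>\<P>. A.biconn P"
      "card \<P> \<le> (n - 1) div ?d"
    by (auto simp: A.splits_def)
  have "k_connected 2 (G \<restriction> P)" if "P \<in> \<P>" for P
    using k_connected_2_of_biconn[of P] P(2) partition_onD1[OF P(1)] that by auto
  then have "k_proper_partition 2 G \<P>" using P(1) by (simp add: k_proper_partition_def)
  moreover have "card \<P> * ?d \<le> n - 1" using P(3) d by (simp add: less_eq_div_iff_mult_less_eq)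
  then have "real (card \<P> * ?d) \<le> real (n - 1)" by (simp only: of_nat_le_iff)
  then have "real (card \<P>) \<le> (real n - 1) / real ?d"
    using d n by (simp add: pos_le_divide_eq of_nat_diff)
  ultimately show ?thesis by blast
qed

end
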